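(* Let $\mathbf Y=\boldsymbol\Gamma(\mathbf Y)$ be an elementary system of $k$ set-equations. Then: (a) There is a unique solution $\mathbf T\in\mathrm{Su}(\mathbb P)^k$, and for every $\mathbf A\in\mathrm{Su}(\mathbb P)^k$, $\mathbf T=\lim_{n\to\infty}\boldsymbol\Gamma^{(n)}(\mathbf A)$, meaning: for every $M$ there is $n_0$ such that for all $n\ge n_0$ and all $i$, $\Gamma^{(n)}_{\ i}(\mathbf A)\cap[0,M]=T_i\cap[0,M]$. (b) $T_i=\emptyset$ iff $\Gamma^{(k)}_{\ i}(\boldsymbol\emptyset)=\emptyset$. Assume in addition that the system is reduced. Then: (c) If $[i]\neq\emptyset$ then $T_i$ is periodic. If moreover there are $j\in[i]$ and $\mathbf u\in\mathbb N^k$ with $\Gamma_{j,\mathbf u}\neq\emptyset$ and $\sum_{\ell\in[i]}u_\ell\ge 2$, then $T_i$ is the union of a finite set and a single arithmetical progression. (d) Let "P" mean either "periodic" throughout or "eventually periodic" throughout. Suppose $[i]=\emptyset$ and the $i$th equation can be written as $\Gamma_i(\mathbf Y)=P_i+\bigcup_{Q\in\mathfrak Q_i}\sum_{j=1}^kQ_j\star Y_j$ for all $\mathbf Y$, where $P_i\subseteq\mathbb N$ is P and $\mathfrak Q_i$ is a finite set of $k$-tuples $Q=(Q_1,\dots,Q_k)$ of P subsets of $\mathbb N$, and suppose $T_j$ is P for every $j$ with $i\to j$. Then $T_i$ is P. (e) With $\mathfrak m_i=\mathfrak m(T_i)$, $\boldsymbol{\mathfrak m}=(\mathfrak m_1,\dots,\mathfrak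 m_k)$ and $\mathfrak q_i=\mathfrak q(T_i)$: $$\mathfrak m_i=\min\Gamma^{(k)}_{\ i}(\boldsymbol\emptyset),\qquad \mathfrak q_i=\gcd\Big(\bigcup_{j:\,i\to^\star j}\ \bigcup_{\mathbf u\in\mathbb N^k}\big(\Gamma_{j,\mathbf u}+\textstyle\sum_{\ell=1}^k u_\ell\mathfrak m_\ell-\mathfrak m_j\big)\Big).$$ (f) $\mathfrak q_i\mid\mathfrak q_j$ whenever $i\to j$.
   Context: $\mathbb N=\{0,1,\dots\}$, $\mathbb P=\{1,2,\dots\}$, $\mathrm{Su}(X)$ the set of subsets of $X$. For $A,B\subseteq\mathbb N$: $A+B=\{a+b\}$ (empty if either is empty), $c+B=\{c+b\}$; $n\star B=\{0\}$ if $n=0$ and $B+\cdots+B$ ($n$ copies) if $n\ge1$. For $\mathbf u\in\mathbb N^k$, $\mathbf u\star\mathbf Y=u_1\star Y_1+\cdots+u_k\star Y_k$. A system of set-equations is $\mathbf Y=\boldsymbol\Gamma(\mathbf Y)$ with $\Gamma_i(\mathbf Y)=\bigcup_{\mathbf u\in\mathbb N^k}(\Gamma_{i,\mathbf u}+\mathbf u\star\mathbf Y)$, $1\le i\le k$, for fixed $\Gamma_{i,\mathbf u}\subseteq\mathbb N$. It is basic if $\boldsymbol\Gamma$ maps $\mathrm{Su}(\mathbb P)^k$ into itself (equivalently $0\notin\Gamma_{i,\mathbf 0}$ for all $i$); elementary if it is basic and $0\in\Gamma_{i,\mathbf u}$ implies $\sum_j u_j\ge2$; reduced elementary if moreover no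 coordinate of $\boldsymbol\Gamma^{(k)}(\boldsymbol\emptyset)$ is empty. $\boldsymbol\Gamma^{(n)}$ is the $n$-fold composition, $\Gamma^{(n)}_{\ i}$ its $i$th component, $\boldsymbol\emptyset=(\emptyset,\dots,\emptyset)$. Dependency digraph: vertices $1,\dots,k$, edge $i\to j$ iff there is $\mathbf u$ with $\Gamma_{i,\mathbf u}\neq\emptyset$ and $u_j>0$; $\to^+$ is its transitive closure, $\to^\star$ its reflexive-transitive closure, and $[i]=\{j:i\to^+j\to^+i\}$. A set $A\subseteq\mathbb N$ is periodic if $p+A\subseteq A$ for some positive integer $p$, eventually periodic if for some positive $p$ and some $m$, $a\in A,a\ge m\Rightarrow a+p\in A$. An arithmetical progression is a set $a+b\mathbb N$ with $a\in\mathbb N$, $b\ge1$. For non-empty $A$, $\mathfrak m(A)=\min A$, $\mathfrak q(A)=\gcd\{a-\min A:a\in A\}$ with $\gcd\{0\}=0$; the gcd in (e) is of a set of integers. *)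

theory Defs
  imports "HOL-Library.Set_Algebras" "HOL-Library.Cardinality"
begin

text \<open>
  Sets of naturals carry the sumset operation \<open>A + B\<close> of Set_Algebras, whose neutral element is
  \<open>{0}\<close>. A system of \<open>k\<close> equations is indexed by a finite type with \<open>k\<close> elements and given by its
  coefficient sets \<open>G i u = \<Gamma>\<^sub>i\<^sub>,\<^sub>u\<close>.
\<close>

type_synonym 'k system = "'k \<Rightarrow> ('k \<Rightarrow> nat) \<Rightarrow> nat set"

primrec nstar :: "nat \<Rightarrow> nat set \<Rightarrow> nat set" where
  "nstar 0 B = {0}"
| "nstar (Suc n) B = B + nstar n B"

definition set_star :: "nat set \<Rightarrow> nat set \<Rightarrow> nat set" where
  "set_star Q B = (\<Union>q\<in>Q. nstar q B)"

definition vec_star :: "('k::finite \<Rightarrow> nat) \<Rightarrow> ('k \<Rightarrow> nat set) \<Rightarrow> nat set" where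
  "vec_star u Y = (\<Sum>j\<in>UNIV. nstar (u j) (Y j))"

definition Gam :: "'k::finite system \<Rightarrow> ('k \<Rightarrow> nat set) \<Rightarrow> ('k \<Rightarrow> nat set)" where
  "Gam G Y = (\<lambda>i. \<Union>u. G i u + vec_star u Y)"

definition SuP :: "('k \<Rightarrow> nat set) set" where
  "SuP = {Y. \<forall>i. Y i \<subseteq> {1..}}"

definition basic_system :: "'k::finite system \<Rightarrow> bool" where
  "basic_system G \<longleftrightarrow> Gam G ` SuP \<subseteq> SuP"

definition elementary_system :: "'k::finite system \<Rightarrow> bool" where
  "elementary_system G \<longleftrightarrow>
     basic_system G \<and> (\<forall>i u. 0 \<in> G i u \<longrightarrow> (\<Sum>j\<in>UNIV. u j) \<ge> 2)"

definition reduced_elementary_system :: "'k::finite system \<Rightarrow> bool" where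
  "reduced_elementary_system G \<longleftrightarrow>
     elementary_system G \<and> (\<forall>i. (Gam G ^^ CARD('k)) (\<lambda>_. {}) i \<noteq> {})"

definition solution :: "'k::finite system \<Rightarrow> ('k \<Rightarrow> nat set) \<Rightarrow> bool" where
  "solution G T \<longleftrightarrow> T \<in> SuP \<and> T = Gam G T"

definition dep :: "'k system \<Rightarrow> ('k \<times> 'k) set" where
  "dep G = {(i, j). \<exists>u. G i u \<noteq> {} \<and> u j > 0}"

definition strong_class :: "'k system \<Rightarrow> 'k \<Rightarrow> 'k set" where
  "strong_class G i = {j. (i, j) \<in> (dep G)\<^sup>+ \<and> (j, i) \<in> (dep G)\<^sup>+}"

definition periodic :: "nat set \<Rightarrow> bool" where
  "periodic A \<longleftrightarrow> (\<exists>p>0. \<forall>a\<in>A. p + a \<in> A)"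

definition eventually_periodic :: "nat set \<Rightarrow> bool" where
  "eventually_periodic A \<longleftrightarrow> (\<exists>p>0. \<exists>m. \<forall>a\<in>A. a \<ge> m \<longrightarrow> a + p \<in> A)"

definition arith_progression :: "nat set \<Rightarrow> bool" where
  "arith_progression A \<longleftrightarrow> (\<exists>a b. b \<ge> 1 \<and> A = {a + b * n | n. True})"

definition min_elem :: "nat set \<Rightarrow> nat" where
  "min_elem A = (LEAST a. a \<in> A)"

definition gap_gcd :: "nat set \<Rightarrow> nat" where
  "gap_gcd A = Gcd ((\<lambda>a. a - min_elem A) ` A)"

end

theory Submission
  imports Defs "HOL-Computational_Algebra.Group_Closure" "HOL-Number_Theory.Cong"
begin

text \<open>
  In an elementary system a produced number is strictly larger than each of its summands from the
  unknowns. So \<open>Gam G\<close> contracts on initial segments, and a minimum of the solution is built from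
  strictly smaller minima, hence appears within \<open>k\<close> steps. If all components are nonempty, a
  dependency \<open>i \<rightarrow> j\<close> shifts \<open>T j\<close> into \<open>T i\<close> by a positive constant: cycles yield periods,
  divisibility of the gap gcds propagates along dependencies, and a branching inside a strong class
  gives \<open>c + T i + T i \<subseteq> T i\<close>, so that \<open>c + T i\<close> is an additive semigroup.
\<close>

section \<open>Weighted sumsets\<close>

definition incr :: "'k \<Rightarrow> ('k \<Rightarrow> nat) \<Rightarrow> 'k \<Rightarrow> nat" where
  "incr j u = u(j := Suc (u j))"

lemma incr_same [simp]: "incr j u j = Suc (u j)"
  by (simp add: incr_def)

lemma incr_pos: "0 < u l \<Longrightarrow> 0 < incr j u l"
  by (simp add: incr_def)

lemma incr_cases:
  assumes "0 < u j"
  obtains v where "u = incr j v"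
proof
  show "u = incr j (u(j := u j - 1))"
    using assms by (auto simp: incr_def)
qed

lemma sum_incr:
  assumes "finite A"
  shows "(\<Sum>l\<in>A. incr j u l) = (\<Sum>l\<in>A. u l) + of_bool (j \<in> A)"
  proof -
  have "incr j u l = u l + of_bool (l = j)" for l
    by (simp add: incr_def)
  then show ?thesis
    using assms by (simp add: sum.distrib of_bool_def)
qed

lemma sum_incr_mult:
  fixes u :: "'k::finite \<Rightarrow> nat"
  shows "(\<Sum>l\<in>UNIV. incr j u l * x l) = x j + (\<Sum>l\<in>UNIV. u l * x l)"
  by (simp add: incr_def sum.remove[of UNIV j])

lemma incr_induct [case_names zero incr]:
  fixes u :: "'k::finite \<Rightarrow> nat"
  assumes "P (\<lambda>_. 0)" and "\<And>u j. P u \<Longrightarrow> P (incr j u)"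
  shows "P u"
proof (induction "\<Sum>l\<in>UNIV. u l" arbitrary: u)
  case 0
  then have "u = (\<lambda>_. 0)"
    by auto
  then show ?case
    using assms(1) by simp
next
  case (Suc n)
  then obtain j where "0 < u j"
    by (metis gr0I nat.distinct(1) sum.neutral)
  then obtain v where "u = incr j v"
    by (rule incr_cases)
  then show ?case
    using Suc assms(2) by (simp add: sum_incr)
qed

lemma vec_star_zero: "vec_star (\<lambda>_. 0) Y = {0}"
  by (simp add: vec_star_def flip: set_zero)

lemma vec_star_incr: "vec_star (incr j u) Y = Y j + vec_star u Y"
  unfolding vec_star_def by (simp add: incr_def sum.remove[of UNIV j] add.assoc)

lemma add_mem_vec_star_incr:
  "y \<in> Y j \<Longrightarrow> w \<in> vec_star u Y \<Longrightarrow> y + w \<in> vec_star (incr j u) Y"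
  by (simp add: vec_star_incr set_plus_intro)

lemma vec_star_induct [consumes 1, case_names zero incr]:
  assumes "w \<in> vec_star u Y"
    and "P (\<lambda>_. 0) 0"
    and "\<And>u w j y. w \<in> vec_star u Y \<Longrightarrow> P u w \<Longrightarrow> y \<in> Y j \<Longrightarrow> P (incr j u) (y + w)"
  shows "P u w"
  using assms(1)
proof (induction u arbitrary: w rule: incr_induct)
  case zero
  then show ?case
    using assms(2) by (simp add: vec_star_zero)
next
  case (incr u j)
  then show ?case
    using assms(3) by (auto simp: vec_star_incr elim!: set_plus_elim)
qed

lemma vec_star_mono:
  assumes "\<And>l. 0 < u l \<Longrightarrow> Y l \<subseteq> Z l"
  shows "vec_star u Y \<subseteq> vec_star u Z"
  using assms
proof (induction u rule: incr_induct)
  case zero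
  then show ?case
    by (simp add: vec_star_zero)
next
  case (incr u j)
  then show ?case
    by (simp add: vec_star_incr incr_pos set_plus_mono2)
qed

lemma sum_mult_mem_vec_star:
  assumes "\<And>l. x l \<in> Y l"
  shows "(\<Sum>l\<in>UNIV. u l * x l) \<in> vec_star u Y"
proof (induction u rule: incr_induct)
  case zero
  then show ?case
    by (simp add: vec_star_zero)
next
  case (incr u j)
  then show ?case
    by (simp add: sum_incr_mult add_mem_vec_star_incr assms)
qed

lemma vec_star_nonempty: "(\<And>l. Y l \<noteq> {}) \<Longrightarrow> vec_star u Y \<noteq> {}"
  using sum_mult_mem_vec_star[of "\<lambda>l. SOME y. y \<in> Y l" Y u] some_in_eq by blast

lemma vec_star_dominated:
  assumes "w \<in> vec_star u Y" and "\<And>l y. y \<in> Y l \<Longrightarrow> \<exists>z\<in>Z l. z \<le> y"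
  shows "\<exists>v\<in>vec_star u Z. v \<le> w"
  using assms(1)
proof (induction rule: vec_star_induct)
  case zero
  then show ?case
    by (simp add: vec_star_zero)
next
  case (incr u w j y)
  then obtain v z where "v \<in> vec_star u Z" "v \<le> w" "z \<in> Z j" "z \<le> y"
    using assms(2) by blast
  then show ?case
    by (intro bexI[of _ "z + v"] add_mono add_mem_vec_star_incr)
qed

lemma vec_star_cong_sum_mult:
  assumes "w \<in> vec_star u Y" and "\<And>l y. 0 < u l \<Longrightarrow> y \<in> Y l \<Longrightarrow> [y = x l] (mod d)"
  shows "[w = (\<Sum>l\<in>UNIV. u l * x l)] (mod d)"
  using assms
proof (induction rule: vec_star_induct)
  case zero
  then show ?case
    by simp
next
  case (incr u w j y)
  then show ?case
    by (simp add: sum_incr_mult cong_add incr_pos)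
qed

lemma SuP_iff_le: "Y \<in> SuP \<longleftrightarrow> Y \<le> (\<lambda>_. {1..})"
  by (simp add: SuP_def le_fun_def)

lemma SuP_pos: "Y \<in> SuP \<Longrightarrow> y \<in> Y j \<Longrightarrow> 0 < y"
  by (force simp: SuP_def)

lemma sum_le_of_mem_vec_star:
  assumes "w \<in> vec_star u Y" and "Y \<in> SuP"
  shows "(\<Sum>l\<in>UNIV. u l) \<le> w"
  using assms(1)
proof (induction rule: vec_star_induct)
  case (incr u w j y)
  then show ?case
    using SuP_pos[OF assms(2) incr.hyps(2)] by (simp add: sum_incr)
qed simp

text \<open>Each of the other summands contributes at least \<open>1\<close> to \<open>w\<close>.\<close>

lemma vec_star_bounded_summands:
  assumes "w \<in> vec_star u Y" and "Y \<in> SuP"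
  shows "w \<in> vec_star u (\<lambda>j. Y j \<inter> {y. y + (\<Sum>l\<in>UNIV. u l) \<le> Suc w})"
  using assms(1)
proof (induction rule: vec_star_induct)
  case zero
  then show ?case
    by (simp add: vec_star_zero)
next
  case (incr u w j y)
  let ?Z = "\<lambda>l. Y l \<inter> {z. z + (\<Sum>l\<in>UNIV. incr j u l) \<le> Suc (y + w)}"
  have "y \<in> ?Z j"
    using incr.hyps(2) sum_le_of_mem_vec_star[OF incr.hyps(1) assms(2)] by (simp add: sum_incr)
  moreover have "w \<in> vec_star u ?Z"
  proof (rule subsetD[OF vec_star_mono incr.IH])
    show "Y l \<inter> {z. z + (\<Sum>l\<in>UNIV. u l) \<le> Suc w} \<subseteq> ?Z l" for l
      using SuP_pos[OF assms(2) incr.hyps(2)] by (auto simp: sum_incr)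
  qed
  ultimately show ?case
    by (rule add_mem_vec_star_incr)
qed

section \<open>The operator of a system\<close>

lemma mem_Gam_iff: "n \<in> Gam G Y i \<longleftrightarrow> (\<exists>u. \<exists>g\<in>G i u. \<exists>w\<in>vec_star u Y. n = g + w)"
  by (auto simp: Gam_def set_plus_def)

lemma Gam_mono: "mono (Gam G)"
proof (intro monoI le_funI)
  fix Y Z :: "'a \<Rightarrow> nat set" and i
  assume "Y \<le> Z"
  then have "vec_star u Y \<subseteq> vec_star u Z" for u
    by (intro vec_star_mono) (simp add: le_fun_def)
  then show "Gam G Y i \<subseteq> Gam G Z i"
    by (force simp: mem_Gam_iff)
qed

lemma Gam_cong_dep:
  assumes "\<And>j. (i, j) \<in> dep G \<Longrightarrow> Y j = Z j"
  shows "Gam G Y i = Gam G Z i"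
proof -
  have "vec_star u Y = vec_star u Z" if "g \<in> G i u" for u g
  proof -
    have "Y l = Z l" if "0 < u l" for l
      using that \<open>g \<in> G i u\<close> assms[of l] by (auto simp: dep_def)
    then show ?thesis
      by (intro equalityI vec_star_mono) auto
  qed
  then show ?thesis
    by (auto simp: mem_Gam_iff)
qed

lemma Gam_dominated:
  assumes "n \<in> Gam G Y i" and "\<And>l y. y \<in> Y l \<Longrightarrow> \<exists>z\<in>Z l. z \<le> y"
  shows "\<exists>n'\<in>Gam G Z i. n' \<le> n"
proof -
  obtain u g w where "g \<in> G i u" "w \<in> vec_star u Y" "n = g + w"
    using assms(1) unfolding mem_Gam_iff by blast
  moreover from this obtain v where "v \<in> vec_star u Z" "v \<le> w"
    using vec_star_dominated assms(2) by blast
  ultimately show ?thesis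
    by (intro bexI[of _ "g + v"]) (auto simp: mem_Gam_iff)
qed

lemma funpow_Gam_empty_mono:
  "n \<le> n' \<Longrightarrow> (Gam G ^^ n) (\<lambda>_. {}) i \<subseteq> (Gam G ^^ n') (\<lambda>_. {}) i"
  using funpow_decreasing[OF _ Gam_mono, of n n' G] by (simp add: bot_fun_def le_fun_def)

lemma Gam_in_SuP: "elementary_system G \<Longrightarrow> Y \<in> SuP \<Longrightarrow> Gam G Y \<in> SuP"
  by (auto simp: elementary_system_def basic_system_def)

lemma funpow_Gam_in_SuP: "elementary_system G \<Longrightarrow> Y \<in> SuP \<Longrightarrow> (Gam G ^^ n) Y \<in> SuP"
  by (induction n) (simp_all add: Gam_in_SuP)

lemma elementary_weight_ge_2:
  assumes "elementary_system G" and "g \<in> G i u" and "0 < (\<Sum>l\<in>UNIV. u l)"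
  shows "2 \<le> g + (\<Sum>l\<in>UNIV. u l)"
proof (cases "g = 0")
  case True
  then show ?thesis
    using assms by (auto simp: elementary_system_def)
qed (use assms(3) in linarith)

lemma mem_Gam_below:
  assumes "elementary_system G" and "Y \<in> SuP" and "n \<in> Gam G Y i"
  shows "n \<in> Gam G (\<lambda>j. Y j \<inter> {..<n}) i"
proof -
  obtain u g w where coeff: "g \<in> G i u" and weighted_sum: "w \<in> vec_star u Y" and n_eq: "n = g + w"
    using assms(3) unfolding mem_Gam_iff by blast
  have "Y j \<inter> {y. y + (\<Sum>l\<in>UNIV. u l) \<le> Suc w} \<subseteq> Y j \<inter> {..<n}" if "0 < u j" for j
  proof -
    have "0 < (\<Sum>l\<in>UNIV. u l)"
      by (rule sum_pos2[where f = u]) (use that in auto)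
    then show ?thesis
      using elementary_weight_ge_2[OF assms(1) coeff] n_eq by auto
  qed
  then have "w \<in> vec_star u (\<lambda>j. Y j \<inter> {..<n})"
    by (rule subsetD[OF vec_star_mono vec_star_bounded_summands[OF weighted_sum assms(2)]])
  then show ?thesis
    using coeff n_eq by (auto simp: mem_Gam_iff)
qed

lemma Gam_contracting:
  assumes "elementary_system G" and "Y \<in> SuP" and "\<And>j. Y j \<inter> {..<n} \<subseteq> Z j"
  shows "Gam G Y i \<inter> {..<Suc n} \<subseteq> Gam G Z i"
proof
  fix x
  assume x_below: "x \<in> Gam G Y i \<inter> {..<Suc n}"
  then have "x \<in> Gam G (\<lambda>j. Y j \<inter> {..<x}) i"
    using mem_Gam_below[OF assms(1,2)] by blast
  moreover have "(\<lambda>j. Y j \<inter> {..<x}) \<le> Z"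
    using x_below assms(3) by (fastforce simp: le_fun_def)
  ultimately show "x \<in> Gam G Z i"
    using Gam_mono[THEN monoD] by (blast dest: le_funD)
qed

lemma funpow_Gam_below_subset:
  assumes "elementary_system G" and "Y \<in> SuP"
  shows "(Gam G ^^ n) Y i \<inter> {..<n} \<subseteq> (Gam G ^^ n) Z i"
proof (induction n arbitrary: i)
  case (Suc n)
  then show ?case
    using Gam_contracting[OF assms(1) funpow_Gam_in_SuP[OF assms]] by simp
qed simp

section \<open>The solution of an elementary system\<close>

lemma solution_exists:
  assumes "elementary_system G"
  shows "\<exists>T. solution G T"
proof
  have "Gam G (\<lambda>_. {1..}) \<le> (\<lambda>_. {1..})"
    using Gam_in_SuP[OF assms, of "\<lambda>_. {1..}"] by (simp add: SuP_iff_le)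
  then have "lfp (Gam G) \<in> SuP"
    unfolding SuP_iff_le by (rule lfp_lowerbound)
  then show "solution G (lfp (Gam G))"
    unfolding solution_def using lfp_unfold[OF Gam_mono] by (rule conjI)
qed

lemma funpow_solution: "solution G T \<Longrightarrow> (Gam G ^^ n) T = T"
  by (induction n) (auto simp: solution_def)

lemma funpow_Gam_eq_solution:
  assumes "elementary_system G" and "solution G T" and "A \<in> SuP" and "M < n"
  shows "(Gam G ^^ n) A i \<inter> {0..M} = T i \<inter> {0..M}"
proof -
  have "T \<in> SuP"
    using assms(2) by (simp add: solution_def)
  then have "(Gam G ^^ n) A i \<inter> {..<n} \<subseteq> T i" "T i \<inter> {..<n} \<subseteq> (Gam G ^^ n) A i"
    using funpow_Gam_below_subset[OF assms(1,3), where Z = T]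
      funpow_Gam_below_subset[OF assms(1), where Y = T]
    by (simp_all only: funpow_solution[OF assms(2)])
  moreover have "{0..M} \<subseteq> {..<n}"
    using assms(4) by auto
  ultimately show ?thesis
    by blast
qed

lemma solution_unique:
  assumes "elementary_system G" and "solution G S" and "solution G T"
  shows "S = T"
proof (intro ext set_eqI)
  fix i x
  have "S \<in> SuP"
    using assms(2) by (simp add: solution_def)
  then have "S i \<inter> {0..x} = T i \<inter> {0..x}"
    using funpow_Gam_eq_solution[OF assms(1,3) _ lessI] funpow_solution[OF assms(2)] by metis
  moreover have "x \<in> {0..x}"
    by simp
  ultimately show "x \<in> S i \<longleftrightarrow> x \<in> T i"
    by blast
qed

lemma min_elem_in: "A \<noteq> {} \<Longrightarrow> min_elem A \<in> A"
  unfolding min_elem_def by (metis LeastI equals0I)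

lemma min_elem_le: "a \<in> A \<Longrightarrow> min_elem A \<le> a"
  unfolding min_elem_def by (rule Least_le)

locale elementary_solution =
  fixes G :: "'k::finite system" and T :: "'k \<Rightarrow> nat set"
  assumes elementary: "elementary_system G" and solution: "solution G T"
begin

abbreviation min_T :: "'k \<Rightarrow> nat" ("\<mm>") where
  "\<mm> i \<equiv> min_elem (T i)"

lemma T_in_SuP: "T \<in> SuP"
  using solution by (simp add: solution_def)

lemma Gam_T: "Gam G T = T"
  using solution by (simp add: solution_def)

lemma add_mem_T: "g \<in> G i u \<Longrightarrow> w \<in> vec_star u T \<Longrightarrow> g + w \<in> T i"
  by (subst Gam_T[symmetric]) (auto simp: mem_Gam_iff)

lemma mem_T_below: "n \<in> T i \<Longrightarrow> n \<in> Gam G (\<lambda>j. T j \<inter> {..<n}) i"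
  using mem_Gam_below[OF elementary T_in_SuP] by (simp add: Gam_T)

lemma funpow_Gam_empty_subset_T: "(Gam G ^^ n) (\<lambda>_. {}) i \<subseteq> T i"
proof -
  have "(Gam G ^^ n) (\<lambda>_. {}) \<le> (Gam G ^^ n) T"
    by (intro funpow_mono Gam_mono) (simp add: le_fun_def)
  then show ?thesis
    by (simp add: funpow_solution[OF solution] le_fun_def)
qed

lemma min_T_in_funpow_Gam_empty:
  assumes "T i \<noteq> {}"
  shows "\<mm> i \<in> (Gam G ^^ card {j. \<mm> j \<le> \<mm> i}) (\<lambda>_. {}) i"
  using assms
proof (induction "\<mm> i" arbitrary: i rule: less_induct)
  case less
  define Y where "Y = (Gam G ^^ card {j. \<mm> j < \<mm> i}) (\<lambda>_. {})"
  have "\<exists>z\<in>Y l. z \<le> y" if below: "y \<in> T l \<inter> {..<\<mm> i}" for l y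
  proof
    have "\<mm> l \<le> y"
      using below by (simp add: min_elem_le)
    then have "\<mm> l < \<mm> i"
      using below by simp
    then have "card {j. \<mm> j \<le> \<mm> l} \<le> card {j. \<mm> j < \<mm> i}"
      by (intro card_mono) auto
    then show "\<mm> l \<in> Y l"
      using less.hyps[OF \<open>\<mm> l < \<mm> i\<close>] below funpow_Gam_empty_mono unfolding Y_def by blast
    show "\<mm> l \<le> y"
      by fact
  qed
  then obtain n where "n \<in> Gam G Y i" and n_le: "n \<le> \<mm> i"
    using Gam_dominated[OF mem_T_below[OF min_elem_in[OF less.prems]]] by blast
  then have funpow: "n \<in> (Gam G ^^ Suc (card {j. \<mm> j < \<mm> i})) (\<lambda>_. {}) i"
    by (simp add: Y_def)
  then have "n \<in> T i"
    using funpow_Gam_empty_subset_T by blast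
  then have "n = \<mm> i"
    using n_le min_elem_le by (simp add: le_antisym)
  moreover have "card {j. \<mm> j < \<mm> i} < card {j. \<mm> j \<le> \<mm> i}"
    by (intro psubset_card_mono) auto
  ultimately show ?case
    using funpow funpow_Gam_empty_mono[OF Suc_leI] by blast
qed

lemma min_T_in_funpow_Gam_CARD:
  assumes "T i \<noteq> {}"
  shows "\<mm> i \<in> (Gam G ^^ CARD('k)) (\<lambda>_. {}) i"
proof -
  have "card {j. \<mm> j \<le> \<mm> i} \<le> CARD('k)"
    by (simp add: card_mono)
  then show ?thesis
    using min_T_in_funpow_Gam_empty[OF assms] funpow_Gam_empty_mono by blast
qed

lemma T_empty_iff: "T i = {} \<longleftrightarrow> (Gam G ^^ CARD('k)) (\<lambda>_. {}) i = {}"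
  using min_T_in_funpow_Gam_CARD funpow_Gam_empty_subset_T by blast

lemma min_T_eq:
  assumes "T i \<noteq> {}"
  shows "\<mm> i = min_elem ((Gam G ^^ CARD('k)) (\<lambda>_. {}) i)" (is "_ = min_elem ?E")
proof (rule antisym)
  have "?E \<noteq> {}"
    using assms T_empty_iff by simp
  then have "min_elem ?E \<in> T i"
    using min_elem_in funpow_Gam_empty_subset_T by blast
  then show "\<mm> i \<le> min_elem ?E"
    by (rule min_elem_le)
  show "min_elem ?E \<le> \<mm> i"
    using min_T_in_funpow_Gam_CARD[OF assms] by (rule min_elem_le)
qed

end

section \<open>Additively closed sets of natural numbers\<close>

lemma additive_closed_imp_consecutive_multiples:
  fixes S :: "nat set"
  assumes closed: "\<And>a b. a \<in> S \<Longrightarrow> b \<in> S \<Longrightarrow> a + b \<in> S" and "s \<in> S"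
  obtains b where "s \<le> b" and "b \<in> S" and "b + Gcd S \<in> S"
proof -
  have "\<exists>a\<in>S. \<exists>b\<in>S. z = int a - int b" if "z \<in> group_closure (int ` S)" for z
    using that
  proof induction
    case (base z)
    then consider (zero) "z = 0" | (element) a where "a \<in> S" "z = int a"
      by blast
    then show ?case
    proof cases
      case zero
      then show ?thesis
        using \<open>s \<in> S\<close> by force
    next
      case element
      then show ?thesis
        using closed[OF \<open>a \<in> S\<close> \<open>s \<in> S\<close>] \<open>s \<in> S\<close> by (intro bexI[of _ "a + s"] bexI[of _ s]) auto
    qed
  next
    case (diff y z)
    then obtain a b c e where "a \<in> S" "b \<in> S" "y = int a - int b" "c \<in> S" "e \<in> S" "z = int c - int e"
      by blast
    then show ?case
      using closed by (intro bexI[of _ "a + e"] bexI[of _ "b + c"]) auto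
  qed
  moreover have "int (Gcd S) \<in> group_closure (int ` S)"
    using Gcd_in_group_closure[of "int ` S"] by simp
  ultimately obtain a b where "a \<in> S" "b \<in> S" "a = b + Gcd S"
    by (metis add.commute diff_eq_eq of_nat_add of_nat_eq_iff)
  then show ?thesis
    using closed \<open>s \<in> S\<close> that[of "s + b"] by (simp add: add.assoc)
qed

text \<open>
  If \<open>b\<close> and \<open>b + d\<close> lie in \<open>S\<close>, where \<open>d = Gcd S\<close>, a multiple \<open>n = q * b + r * d\<close> of \<open>d\<close> with
  \<open>r * d < b \<le> q\<close> is \<open>(q - r) * b + r * (b + d)\<close>.
\<close>

lemma additive_closed_eventually_iff_Gcd_dvd:
  fixes S :: "nat set"
  assumes closed: "\<And>a b. a \<in> S \<Longrightarrow> b \<in> S \<Longrightarrow> a + b \<in> S" and "s \<in> S" and "0 < s"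
  shows "\<forall>\<^sub>F n in sequentially. n \<in> S \<longleftrightarrow> Gcd S dvd n"
proof -
  define d where "d = Gcd S"
  obtain b where "s \<le> b" and b_in: "b \<in> S" "b + d \<in> S"
    using additive_closed_imp_consecutive_multiples[of S s] assms unfolding d_def by blast
  have "0 < d"
    using \<open>s \<in> S\<close> \<open>0 < s\<close> unfolding d_def by (metis Gcd_dvd dvd_pos_nat)
  have add_mult: "y + m * x \<in> S" if "x \<in> S" "y \<in> S" for m x y
    using that(2) by (induction m) (use closed[OF that(1)] in \<open>auto simp: add.left_commute\<close>)
  have "n \<in> S" if "b * b \<le> n" "d dvd n" for n
  proof -
    have "d dvd n mod b"
      using b_in(1) \<open>d dvd n\<close> unfolding d_def by (simp add: dvd_mod)
    then obtain r where mod_eq: "n mod b = d * r" ..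
    have "r \<le> d * r"
      using \<open>0 < d\<close> by simp
    also have "d * r < b"
      using \<open>s \<le> b\<close> \<open>0 < s\<close> by (simp flip: mod_eq)
    also have "b \<le> n div b"
      using div_le_mono[OF \<open>b * b \<le> n\<close>, of b] \<open>d * r < b\<close> by simp
    finally obtain p where "n div b = Suc (r + p)"
      by (auto dest: less_imp_Suc_add)
    then have "n = (b + p * b) + r * (b + d)"
      using div_mult_mod_eq[of n b] by (simp add: mod_eq algebra_simps)
    then show ?thesis
      using add_mult b_in by simp
  qed
  then show ?thesis
    unfolding d_def by (intro eventually_sequentiallyI[of "b * b"]) auto
qed

definition finite_Un_progression :: "nat set \<Rightarrow> bool" where
  "finite_Un_progression A \<longleftrightarrow> (\<exists>F S. finite F \<and> arith_progression S \<and> A = F \<union> S)"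

lemma eventually_cong_imp_finite_Un_progression:
  assumes "\<forall>\<^sub>F n in sequentially. n \<in> A \<longleftrightarrow> [n = r] (mod d)" and "0 < d"
  shows "finite_Un_progression A"
proof -
  obtain N where mem_iff_cong: "\<And>n. N \<le> n \<Longrightarrow> n \<in> A \<longleftrightarrow> [n = r] (mod d)"
    using assms(1) unfolding eventually_sequentially by blast
  define a where "a = r + d * N"
  have "N \<le> a"
    using \<open>0 < d\<close> by (cases d) (simp_all add: a_def)
  have "n \<in> A \<longleftrightarrow> (\<exists>m. n = a + d * m)" if "a \<le> n" for n
  proof -
    have "n \<in> A \<longleftrightarrow> [n = a] (mod d)"
      using mem_iff_cong \<open>N \<le> a\<close> that by (simp add: a_def cong_def)
    then show ?thesis
      using that by (simp add: cong_le_nat mult.commute add.commute)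
  qed
  then have "n \<in> A \<longleftrightarrow> n \<in> (A \<inter> {..<a}) \<union> {a + d * m | m. True}" for n
    by (cases "a \<le> n") auto
  then have "A = (A \<inter> {..<a}) \<union> {a + d * m | m. True}"
    by blast
  moreover have "arith_progression {a + d * m | m. True}"
    using \<open>0 < d\<close> unfolding arith_progression_def by (metis One_nat_def Suc_leI)
  ultimately show ?thesis
    unfolding finite_Un_progression_def by (metis finite_Int finite_lessThan)
qed

lemma shifted_additive_closed_imp_finite_Un_progression:
  assumes "a \<in> A" and "0 < a" and add: "\<And>a b. a \<in> A \<Longrightarrow> b \<in> A \<Longrightarrow> c + a + b \<in> A"
  shows "finite_Un_progression A"
proof -
  define S where "S = (\<lambda>n. n + c) ` A"
  have mem_S: "n + c \<in> S \<longleftrightarrow> n \<in> A" for n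
    by (auto simp: S_def)
  have "x + y \<in> S" if xy_in: "x \<in> S" "y \<in> S" for x y
  proof -
    obtain a b where summands: "a \<in> A" "b \<in> A" "x = a + c" "y = b + c"
      using xy_in by (auto simp: S_def)
    then have "c + a + b + c \<in> S"
      using add by (simp only: mem_S)
    then show ?thesis
      by (simp add: summands add_ac)
  qed
  moreover have shifted: "a + c \<in> S" "0 < a + c"
    using assms(1,2) by (simp_all add: mem_S)
  ultimately have "\<forall>\<^sub>F n in sequentially. n \<in> S \<longleftrightarrow> Gcd S dvd n"
    by (rule additive_closed_eventually_iff_Gcd_dvd)
  then have "\<forall>\<^sub>F n in sequentially. n + c \<in> S \<longleftrightarrow> Gcd S dvd n + c"
    by (rule eventually_sequentially_seg[THEN iffD2])
  moreover have "Gcd S dvd n + c \<longleftrightarrow> [n = a] (mod Gcd S)" for n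
  proof -
    have "[a + c = 0] (mod Gcd S)"
      using shifted(1) by (simp add: cong_0_iff)
    then have "Gcd S dvd n + c \<longleftrightarrow> [n + c = a + c] (mod Gcd S)"
      by (metis cong_0_iff cong_sym cong_trans)
    then show ?thesis
      by (simp only: cong_add_rcancel_nat)
  qed
  moreover have "0 < Gcd S"
    using shifted by (metis Gcd_dvd dvd_pos_nat)
  ultimately show ?thesis
    by (intro eventually_cong_imp_finite_Un_progression[of A a "Gcd S"]) (simp_all add: mem_S)
qed

section \<open>Shifts between the components of a reduced system\<close>

definition shifts_into :: "nat set \<Rightarrow> nat set \<Rightarrow> bool" where
  "shifts_into B A \<longleftrightarrow> (\<exists>c>0. \<forall>b\<in>B. c + b \<in> A)"

lemma shifts_into_trans: "shifts_into C B \<Longrightarrow> shifts_into B A \<Longrightarrow> shifts_into C A"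
  unfolding shifts_into_def by (metis add.assoc add_pos_pos)

lemma periodic_iff_shifts_into: "periodic A \<longleftrightarrow> shifts_into A A"
  by (simp add: periodic_def shifts_into_def)

lemma dvd_gap_gcd_iff: "d dvd gap_gcd A \<longleftrightarrow> (\<forall>a\<in>A. [a = min_elem A] (mod d))"
  by (simp add: gap_gcd_def dvd_Gcd_iff cong_altdef_nat min_elem_le)

lemma gap_gcd_dvd_if_shifts_into:
  assumes "shifts_into B A"
  shows "gap_gcd A dvd gap_gcd B"
  unfolding dvd_gap_gcd_iff
proof
  fix b
  assume "b \<in> B"
  moreover obtain c where "\<And>b. b \<in> B \<Longrightarrow> c + b \<in> A"
    using assms by (auto simp: shifts_into_def)
  moreover have "min_elem B \<in> B"
    using \<open>b \<in> B\<close> min_elem_in by blast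
  ultimately have "[c + b = c + min_elem B] (mod gap_gcd A)"
    using dvd_gap_gcd_iff[of "gap_gcd A" A] by (meson cong_sym cong_trans dvd_refl)
  then show "[b = min_elem B] (mod gap_gcd A)"
    by (simp add: cong_add_lcancel_nat)
qed

locale reduced_solution = elementary_solution +
  assumes T_nonempty: "T i \<noteq> {}"
begin

lemma min_T_in: "\<mm> i \<in> T i"
  by (intro min_elem_in T_nonempty)

lemma vec_star_T_nonempty: "vec_star u T \<noteq> {}"
  by (intro vec_star_nonempty T_nonempty)

lemma dep_imp_shifts_into:
  assumes "(i, j) \<in> dep G"
  shows "shifts_into (T j) (T i)"
proof -
  obtain u g where "g \<in> G i u" "0 < u j"
    using assms by (auto simp: dep_def)
  then obtain v where coeff: "g \<in> G i (incr j v)"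
    by (metis incr_cases)
  obtain w where weighted_sum: "w \<in> vec_star v T"
    using vec_star_T_nonempty by blast
  have "2 \<le> g + Suc (\<Sum>l\<in>UNIV. v l)"
    using elementary_weight_ge_2[OF elementary coeff] by (simp add: sum_incr)
  then have "0 < g + w"
    using sum_le_of_mem_vec_star[OF weighted_sum T_in_SuP] by linarith
  moreover have "g + w + t \<in> T i" if "t \<in> T j" for t
    using add_mem_T[OF coeff add_mem_vec_star_incr[OF that weighted_sum]] by (simp add: add_ac)
  ultimately show ?thesis
    unfolding shifts_into_def by blast
qed

lemma dep_trancl_imp_shifts_into: "(i, j) \<in> (dep G)\<^sup>+ \<Longrightarrow> shifts_into (T j) (T i)"
  by (induction rule: trancl_induct) (blast intro: dep_imp_shifts_into shifts_into_trans)+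

lemma periodic_if_strong_class_nonempty: "strong_class G i \<noteq> {} \<Longrightarrow> periodic (T i)"
  unfolding periodic_iff_shifts_into strong_class_def
  by (auto intro: dep_trancl_imp_shifts_into trancl_trans)

lemma finite_Un_progression_if_branching:
  assumes "j \<in> strong_class G i" and "G j u \<noteq> {}" and "2 \<le> (\<Sum>l\<in>strong_class G i. u l)"
  shows "finite_Un_progression (T i)"
proof -
  let ?C = "strong_class G i"
  have pos_entry: "\<exists>a\<in>?C. 0 < v a" if "0 < (\<Sum>l\<in>?C. v l)" for v :: "_ \<Rightarrow> nat"
    using that by (metis gr0I less_irrefl sum.neutral)
  obtain a v where a_in: "a \<in> ?C" and u_eq: "u = incr a v"
    using pos_entry[of u] assms(3) by (fastforce elim: incr_cases)
  have "0 < (\<Sum>l\<in>?C. v l)"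
    using assms(3) a_in by (simp add: u_eq sum_incr)
  then obtain b v' where b_in: "b \<in> ?C" and v_eq: "v = incr b v'"
    using pos_entry by (meson incr_cases)
  obtain g w where coeff: "g \<in> G j u" and weighted_sum: "w \<in> vec_star v' T"
    using assms(2) vec_star_T_nonempty by blast
  have branch: "g + (x + (y + w)) \<in> T j" if "x \<in> T a" "y \<in> T b" for x y
    by (rule add_mem_T[OF coeff])
      (use that weighted_sum in \<open>simp add: u_eq v_eq add_mem_vec_star_incr\<close>)
  have "shifts_into (T i) (T a)" "shifts_into (T i) (T b)" "shifts_into (T j) (T i)"
    using a_in b_in assms(1) by (auto simp: strong_class_def intro: dep_trancl_imp_shifts_into)
  then obtain ca cb cj where shifts: "\<And>t. t \<in> T i \<Longrightarrow> ca + t \<in> T a" "\<And>t. t \<in> T i \<Longrightarrow> cb + t \<in> T b"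
    "\<And>t. t \<in> T j \<Longrightarrow> cj + t \<in> T i"
    unfolding shifts_into_def by blast
  have "(cj + g + ca + cb + w) + s + t \<in> T i" if "s \<in> T i" "t \<in> T i" for s t
  proof -
    have "cj + (g + ((ca + s) + ((cb + t) + w))) \<in> T i"
      using that by (intro shifts branch)
    then show ?thesis
      by (simp add: add_ac)
  qed
  then show ?thesis
    by (rule shifted_additive_closed_imp_finite_Un_progression[OF min_T_in
          SuP_pos[OF T_in_SuP min_T_in]])
qed

lemma gap_gcd_dvd_if_dep: "(i, j) \<in> dep G \<Longrightarrow> gap_gcd (T i) dvd gap_gcd (T j)"
  by (intro gap_gcd_dvd_if_shifts_into dep_imp_shifts_into)

lemma gap_gcd_dvd_if_dep_rtrancl: "(i, j) \<in> (dep G)\<^sup>* \<Longrightarrow> gap_gcd (T i) dvd gap_gcd (T j)"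
  by (induction rule: rtrancl_induct) (auto intro: dvd_trans gap_gcd_dvd_if_dep)

lemma cong_min_T:
  assumes coeffs: "\<And>j u g. (i, j) \<in> (dep G)\<^sup>* \<Longrightarrow> g \<in> G j u \<Longrightarrow>
      [g + (\<Sum>l\<in>UNIV. u l * \<mm> l) = \<mm> j] (mod d)"
    and "(i, j) \<in> (dep G)\<^sup>*" and "t \<in> T j"
  shows "[t = \<mm> j] (mod d)"
  using assms(2,3)
proof (induction t arbitrary: j rule: less_induct)
  case (less t)
  obtain u g w where coeff: "g \<in> G j u"
    and weighted_sum: "w \<in> vec_star u (\<lambda>l. T l \<inter> {..<t})" and t_eq: "t = g + w"
    using mem_T_below[OF less.prems(2)] unfolding mem_Gam_iff by blast
  have "[w = (\<Sum>l\<in>UNIV. u l * \<mm> l)] (mod d)"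
    using weighted_sum
  proof (rule vec_star_cong_sum_mult)
    fix l y
    assume "0 < u l"
    then have "(j, l) \<in> dep G"
      using coeff by (auto simp: dep_def)
    then have "(i, l) \<in> (dep G)\<^sup>*"
      using less.prems(1) by simp
    then show "[y = \<mm> l] (mod d)" if "y \<in> T l \<inter> {..<t}"
      using that less.IH by simp
  qed
  then have "[t = g + (\<Sum>l\<in>UNIV. u l * \<mm> l)] (mod d)"
    by (simp add: t_eq cong_add_lcancel_nat)
  then show ?case
    using coeffs[OF less.prems(1) coeff] by (rule cong_trans)
qed

lemma dvd_gap_gcd_T_iff:
  "d dvd gap_gcd (T i) \<longleftrightarrow>
    (\<forall>j u. \<forall>g\<in>G j u. (i, j) \<in> (dep G)\<^sup>* \<longrightarrow> [g + (\<Sum>l\<in>UNIV. u l * \<mm> l) = \<mm> j] (mod d))"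
proof
  assume d_dvd: "d dvd gap_gcd (T i)"
  show "\<forall>j u. \<forall>g\<in>G j u. (i, j) \<in> (dep G)\<^sup>* \<longrightarrow> [g + (\<Sum>l\<in>UNIV. u l * \<mm> l) = \<mm> j] (mod d)"
  proof (intro allI ballI impI)
    fix j u g
    assume "g \<in> G j u" and "(i, j) \<in> (dep G)\<^sup>*"
    have "(\<Sum>l\<in>UNIV. u l * \<mm> l) \<in> vec_star u T"
      by (intro sum_mult_mem_vec_star min_T_in)
    then have "g + (\<Sum>l\<in>UNIV. u l * \<mm> l) \<in> T j"
      by (rule add_mem_T[OF \<open>g \<in> G j u\<close>])
    moreover have "d dvd gap_gcd (T j)"
      using d_dvd gap_gcd_dvd_if_dep_rtrancl \<open>(i, j) \<in> (dep G)\<^sup>*\<close> by (blast intro: dvd_trans)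
    ultimately show "[g + (\<Sum>l\<in>UNIV. u l * \<mm> l) = \<mm> j] (mod d)"
      by (simp add: dvd_gap_gcd_iff)
  qed
next
  assume "\<forall>j u. \<forall>g\<in>G j u. (i, j) \<in> (dep G)\<^sup>* \<longrightarrow> [g + (\<Sum>l\<in>UNIV. u l * \<mm> l) = \<mm> j] (mod d)"
  then show "d dvd gap_gcd (T i)"
    unfolding dvd_gap_gcd_iff by (auto intro: cong_min_T)
qed

lemma gap_gcd_T_eq:
  "int (gap_gcd (T i)) = Gcd (\<Union>j\<in>{j. (i, j) \<in> (dep G)\<^sup>*}. \<Union>u.
     (\<lambda>g. int g + (\<Sum>l\<in>UNIV. int (u l) * int (\<mm> l)) - int (\<mm> j)) ` G j u)"
  (is "_ = Gcd ?X")
proof -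
  have int_dvd: "int d dvd int g + (\<Sum>l\<in>UNIV. int (u l) * int (\<mm> l)) - int (\<mm> j) \<longleftrightarrow>
      [g + (\<Sum>l\<in>UNIV. u l * \<mm> l) = \<mm> j] (mod d)" for d g u j
    by (simp flip: cong_int_iff add: cong_iff_dvd_diff)
  have "int d dvd int (gap_gcd (T i)) \<longleftrightarrow> int d dvd Gcd ?X" for d
    by (simp add: dvd_Gcd_iff int_dvd dvd_gap_gcd_T_iff)
  moreover obtain e where "Gcd ?X = int e"
    using Gcd_int_greater_eq_0 by (rule nonneg_int_cases)
  ultimately have "d dvd gap_gcd (T i) \<longleftrightarrow> d dvd e" for d
    by (simp only: int_dvd_int_iff)
  then show ?thesis
    using \<open>Gcd ?X = int e\<close> by (metis dvd_antisym dvd_refl)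
qed

end

lemma reduced_solutionI:
  assumes "solution G T" and "reduced_elementary_system G"
  shows "reduced_solution G T"
proof -
  interpret elementary_solution G T
    using assms by unfold_locales (simp_all add: reduced_elementary_system_def)
  show ?thesis
    using assms(2) by unfold_locales (simp add: T_empty_iff reduced_elementary_system_def)
qed

section \<open>Closure properties of periodic and eventually periodic sets\<close>

lemma periodic_plus:
  assumes "periodic A"
  shows "periodic (A + B)"
proof -
  obtain p where period: "0 < p" "\<forall>a\<in>A. p + a \<in> A"
    using assms by (auto simp: periodic_def)
  have "p + x \<in> A + B" if "x \<in> A + B" for x
    using that
  proof (rule set_plus_elim)
    fix a b
    assume "x = a + b" and "a \<in> A" and "b \<in> B"
    then have "(p + a) + b \<in> A + B"
      using period(2) by (intro set_plus_intro) simp_all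
    then show "p + x \<in> A + B"
      by (simp add: \<open>x = a + b\<close> add.assoc)
  qed
  then show ?thesis
    using period(1) by (auto simp: periodic_def)
qed

lemma mult_period_add_mem:
  fixes A :: "nat set"
  assumes "\<forall>a\<in>A. p + a \<in> A" and "a \<in> A"
  shows "n * p + a \<in> A"
  using assms by (induction n) (auto simp: add.assoc)

lemma periodic_Un:
  assumes "periodic A" and "periodic B"
  shows "periodic (A \<union> B)"
proof -
  obtain p q where "0 < p" "\<forall>a\<in>A. p + a \<in> A" "0 < q" "\<forall>b\<in>B. q + b \<in> B"
    using assms by (auto simp: periodic_def)
  then show ?thesis
    unfolding periodic_def using mult_period_add_mem[of A p _ q] mult_period_add_mem[of B q _ p]
    by (intro exI[of _ "p * q"]) (auto simp: mult.commute)
qed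

lemma eventually_periodic_iff:
  "eventually_periodic A \<longleftrightarrow> (\<exists>F R. finite F \<and> periodic R \<and> A = F \<union> R)"
proof
  assume "eventually_periodic A"
  then obtain p m where period: "0 < p" "\<forall>a\<in>A. m \<le> a \<longrightarrow> a + p \<in> A"
    by (auto simp: eventually_periodic_def)
  have "periodic (A \<inter> {m..})"
    unfolding periodic_def using period by (intro exI[of _ p]) (auto simp: add.commute)
  moreover have "A = (A \<inter> {..<m}) \<union> (A \<inter> {m..})"
    by auto
  ultimately show "\<exists>F R. finite F \<and> periodic R \<and> A = F \<union> R"
    by (intro exI[of _ "A \<inter> {..<m}"] exI[of _ "A \<inter> {m..}"]) simp
next
  assume "\<exists>F R. finite F \<and> periodic R \<and> A = F \<union> R"
  then obtain F R p where decomposition: "finite F" "A = F \<union> R" and period: "0 < p" "\<forall>a\<in>R. p + a \<in> R"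
    by (auto simp: periodic_def)
  obtain m where "\<forall>a\<in>F. a < m"
    using decomposition(1) by (auto simp: finite_nat_set_iff_bounded)
  then show "eventually_periodic A"
    unfolding eventually_periodic_def using decomposition period
    by (intro exI[of _ p] conjI exI[of _ m]) (auto simp: add.commute)
qed

lemma eventually_periodic_finite: "finite A \<Longrightarrow> eventually_periodic A"
  unfolding eventually_periodic_iff by (intro exI[of _ A] exI[of _ "{}"]) (auto simp: periodic_def)

lemma eventually_periodic_periodic: "periodic A \<Longrightarrow> eventually_periodic A"
  unfolding eventually_periodic_iff by (intro exI[of _ "{}"] exI[of _ A]) auto

lemma eventually_periodic_Un:
  assumes "eventually_periodic A" and "eventually_periodic B"
  shows "eventually_periodic (A \<union> B)"
proof -
  obtain F R F' R' where "finite F" "periodic R" "A = F \<union> R" "finite F'" "periodic R'" "B = F' \<union> R'"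
    using assms unfolding eventually_periodic_iff by blast
  then show ?thesis
    unfolding eventually_periodic_iff using periodic_Un
    by (intro exI[of _ "F \<union> F'"] exI[of _ "R \<union> R'"]) auto
qed

lemma eventually_periodic_UN:
  "finite I \<Longrightarrow> (\<And>i. i \<in> I \<Longrightarrow> eventually_periodic (A i)) \<Longrightarrow> eventually_periodic (\<Union>i\<in>I. A i)"
  by (induction rule: finite_induct)
    (auto intro: eventually_periodic_Un eventually_periodic_finite)

lemma eventually_periodic_plus:
  assumes "eventually_periodic A" and "eventually_periodic B"
  shows "eventually_periodic (A + B)"
proof -
  obtain F R F' R' where A_decomposition: "finite F" "periodic R" "A = F \<union> R"
    and B_decomposition: "finite F'" "periodic R'" "B = F' \<union> R'"
    using assms unfolding eventually_periodic_iff by blast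
  have "A + B = (F + F') \<union> ((R + B) \<union> (R' + A))"
    unfolding A_decomposition B_decomposition add.commute[of R'] by (auto elim!: set_plus_elim)
  moreover have "periodic ((R + B) \<union> (R' + A))"
    using A_decomposition B_decomposition by (intro periodic_Un periodic_plus)
  moreover have "finite (F + F')"
    using A_decomposition B_decomposition by (simp add: finite_set_plus)
  ultimately show ?thesis
    unfolding eventually_periodic_iff by blast
qed

lemma eventually_periodic_sum:
  "finite I \<Longrightarrow> (\<And>i. i \<in> I \<Longrightarrow> eventually_periodic (A i)) \<Longrightarrow> eventually_periodic (\<Sum>i\<in>I. A i)"
  by (induction rule: finite_induct)
    (auto intro: eventually_periodic_plus eventually_periodic_finite simp: set_zero)

lemma eventually_periodic_nstar: "eventually_periodic A \<Longrightarrow> eventually_periodic (nstar n A)"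
  by (induction n) (auto intro: eventually_periodic_plus eventually_periodic_finite)

lemma nstar_add: "nstar (p + q) B = nstar p B + nstar q B"
  by (induction p) (simp_all add: add.assoc flip: set_zero)

lemma mult_mem_nstar: "b \<in> B \<Longrightarrow> n * b \<in> nstar n B"
  by (induction n) auto

lemma nstar_subset_zero: "B \<subseteq> {0} \<Longrightarrow> nstar n B \<subseteq> {0}"
  by (induction n) (auto elim!: set_plus_elim)

lemma periodic_set_star:
  assumes "periodic Q" and "b \<in> B" and "0 < b"
  shows "periodic (set_star Q B)"
proof -
  obtain p where period: "0 < p" "\<forall>q\<in>Q. p + q \<in> Q"
    using assms(1) by (auto simp: periodic_def)
  have "p * b + x \<in> set_star Q B" if "x \<in> set_star Q B" for x
  proof -
    obtain q where "q \<in> Q" "x \<in> nstar q B"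
      using \<open>x \<in> set_star Q B\<close> by (auto simp: set_star_def)
    then have "p + q \<in> Q" and "p * b + x \<in> nstar (p + q) B"
      using period(2) mult_mem_nstar[OF assms(2)] by (auto simp: nstar_add)
    then show ?thesis
      by (auto simp: set_star_def)
  qed
  then show ?thesis
    unfolding periodic_def using period(1) \<open>0 < b\<close> by (intro exI[of _ "p * b"]) simp
qed

lemma eventually_periodic_set_star:
  assumes "eventually_periodic Q" and "eventually_periodic B"
  shows "eventually_periodic (set_star Q B)"
proof (cases "B \<subseteq> {0}")
  case True
  have "set_star Q B \<subseteq> {0}"
    unfolding set_star_def using nstar_subset_zero[OF True] by (rule UN_least)
  then show ?thesis
    by (intro eventually_periodic_finite) (simp add: finite_subset)
next
  case False
  then obtain b where pos_element: "b \<in> B" "0 < b"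
    by auto
  obtain F R where decomposition: "finite F" "periodic R" "Q = F \<union> R"
    using assms(1) unfolding eventually_periodic_iff by blast
  have "set_star Q B = (\<Union>q\<in>F. nstar q B) \<union> set_star R B"
    by (simp add: set_star_def decomposition(3))
  then show ?thesis
    using decomposition(1) periodic_set_star[OF decomposition(2) pos_element] assms(2)
    by (simp add: eventually_periodic_Un eventually_periodic_UN eventually_periodic_nstar
        eventually_periodic_periodic)
qed

text \<open>
  Components \<open>Y j\<close> with \<open>(i, j) \<notin> dep G\<close> may occur in the right-hand side with arbitrary values;
  since \<open>Gam G Y i\<close> does not depend on them, they can be replaced by the empty set.
\<close>

lemma eventually_periodic_Gam:
  assumes Gam: "\<And>Y. Gam G Y i = R + (\<Union>Q\<in>QQ. \<Sum>j\<in>UNIV. set_star (Q j) (Y j))"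
    and "eventually_periodic R" and "finite QQ" and "\<And>Q j. Q \<in> QQ \<Longrightarrow> eventually_periodic (Q j)"
    and "\<And>j. (i, j) \<in> dep G \<Longrightarrow> eventually_periodic (Y j)"
  shows "eventually_periodic (Gam G Y i)"
proof -
  define Z where "Z j = (if (i, j) \<in> dep G then Y j else {})" for j
  have Z_periodic: "eventually_periodic (Z j)" for j
    using assms(5) by (simp add: Z_def eventually_periodic_finite)
  have "Gam G Y i = Gam G Z i"
    by (rule Gam_cong_dep) (simp add: Z_def)
  moreover have "eventually_periodic (Gam G Z i)"
    unfolding Gam using assms(2-4) Z_periodic
    by (intro eventually_periodic_plus eventually_periodic_UN eventually_periodic_sum
        eventually_periodic_set_star) auto
  ultimately show ?thesis
    by simp
qed

lemma periodic_or_eventually_periodic_Gam: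
  assumes "P \<in> {periodic, eventually_periodic}"
    and Gam: "\<And>Y. Gam G Y i = R + (\<Union>Q\<in>QQ. \<Sum>j\<in>UNIV. set_star (Q j) (Y j))"
    and "P R" and "finite QQ" and "\<And>Q j. Q \<in> QQ \<Longrightarrow> P (Q j)"
    and "\<And>j. (i, j) \<in> dep G \<Longrightarrow> P (Y j)"
  shows "P (Gam G Y i)"
proof -
  consider (periodic) "P = periodic" | (eventually) "P = eventually_periodic"
    using assms(1) by blast
  then show ?thesis
  proof cases
    case periodic
    then show ?thesis
      unfolding Gam using \<open>P R\<close> by (simp add: periodic_plus)
  next
    case eventually
    then show ?thesis
      using assms eventually_periodic_Gam[OF Gam] by blast
  qed
qed

theorem theorem3p8:
  fixes G :: "'k::finite system"
  assumes "elementary_system G"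
  shows "(\<exists>!T. solution G T) \<and>
    (\<forall>T. solution G T \<longrightarrow>
      (\<forall>A\<in>SuP. \<forall>M. \<exists>n0. \<forall>n\<ge>n0. \<forall>i. (Gam G ^^ n) A i \<inter> {0..M} = T i \<inter> {0..M}) \<and>
      (\<forall>i. T i = {} \<longleftrightarrow> (Gam G ^^ CARD('k)) (\<lambda>_. {}) i = {}) \<and>
      (reduced_elementary_system G \<longrightarrow>
        (\<forall>i. strong_class G i \<noteq> {} \<longrightarrow>
          periodic (T i) \<and>
          ((\<exists>j\<in>strong_class G i. \<exists>u. G j u \<noteq> {} \<and> (\<Sum>l\<in>strong_class G i. u l) \<ge> 2) \<longrightarrow>
            (\<exists>F S. finite F \<and> arith_progression S \<and> T i = F \<union> S))) \<and>
        (\<forall>P\<in>{periodic, eventually_periodic}. \<forall>i Pi QQ.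
          strong_class G i = {} \<and>
          P Pi \<and> finite QQ \<and> (\<forall>Q\<in>QQ. \<forall>j. P (Q j)) \<and>
          (\<forall>Y. Gam G Y i = Pi + (\<Union>Q\<in>QQ. \<Sum>j\<in>UNIV. set_star (Q j) (Y j))) \<and>
          (\<forall>j. (i, j) \<in> dep G \<longrightarrow> P (T j)) \<longrightarrow>
          P (T i)) \<and>
        (\<forall>i. min_elem (T i) = min_elem ((Gam G ^^ CARD('k)) (\<lambda>_. {}) i) \<and>
          int (gap_gcd (T i)) =
            Gcd (\<Union>j\<in>{j. (i, j) \<in> (dep G)\<^sup>*}. \<Union>u.
              (\<lambda>g. int g + (\<Sum>l\<in>UNIV. int (u l) * int (min_elem (T l))) - int (min_elem (T j)))
                ` G j u)) \<and>
        (\<forall>i j. (i, j) \<in> dep G \<longrightarrow> gap_gcd (T i) dvd gap_gcd (T j))))"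
proof (intro conjI allI impI ballI)
  show "\<exists>!T. solution G T"
    using solution_exists[OF assms] solution_unique[OF assms] by blast
next
  fix T assume T: "solution G T"
  interpret elementary_solution G T using assms T by unfold_locales
  show "\<exists>n0. \<forall>n\<ge>n0. \<forall>i. (Gam G ^^ n) A i \<inter> {0..M} = T i \<inter> {0..M}" if "A \<in> SuP" for A M
    using funpow_Gam_eq_solution[OF assms T that] Suc_le_lessD by blast
  show "T i = {} \<longleftrightarrow> (Gam G ^^ CARD('k)) (\<lambda>_. {}) i = {}" for i by (rule T_empty_iff)
  show "P (T i)" if "P \<in> {periodic, eventually_periodic}"
    and "strong_class G i = {} \<and> P Pi \<and> finite QQ \<and> (\<forall>Q\<in>QQ. \<forall>j. P (Q j)) \<and>
      (\<forall>Y. Gam G Y i = Pi + (\<Union>Q\<in>QQ. \<Sum>j\<in>UNIV. set_star (Q j) (Y j))) \<and>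
      (\<forall>j. (i, j) \<in> dep G \<longrightarrow> P (T j))" for P i Pi QQ
    using periodic_or_eventually_periodic_Gam[of P G i Pi QQ T] that by (simp only: Gam_T)
next
  fix T i assume "solution G T" and "reduced_elementary_system G"
  then interpret reduced_solution G T by (intro reduced_solutionI)
  show "periodic (T i)" if "strong_class G i \<noteq> {}" using that by (rule periodic_if_strong_class_nonempty)
  show "\<exists>F S. finite F \<and> arith_progression S \<and> T i = F \<union> S"
    if "\<exists>j\<in>strong_class G i. \<exists>u. G j u \<noteq> {} \<and> 2 \<le> (\<Sum>l\<in>strong_class G i. u l)"
    using that finite_Un_progression_if_branching by (auto simp: finite_Un_progression_def)
  show "min_elem (T i) = min_elem ((Gam G ^^ CARD('k)) (\<lambda>_. {}) i)" by (intro min_T_eq T_nonempty)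
  show "gap_gcd (T i) dvd gap_gcd (T j)" if "(i, j) \<in> dep G" for j using that by (rule gap_gcd_dvd_if_dep)
qed (rule reduced_solution.gap_gcd_T_eq[OF reduced_solutionI])

end
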